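(* Let $I$ be a positive integer and let $\mathbf{P}\in\mathcal{S}^{I^2}$ be an $I\times I$ probability table. Then its simplicial skewness $E^2(\mathbf{P})=\|\mathbf{P}_{\mathrm{skew}}\|_A^2$ decomposes into its simplicial quasi-skewness $Q^2(\mathbf{P})=\|\mathbf{P}_{\mathrm{skint}}\|_A^2$ and its simplicial geometric marginal heterogeneity $M^2(\mathbf{P})=\|\mathbf{P}_{\mathrm{skind}}\|_A^2$: $$E^2(\mathbf{P})=Q^2(\mathbf{P})+M^2(\mathbf{P}).$$
   Context: $\mathcal{S}^{I^2}$ is the set of all $I\times I$ tables $\mathbf{P}=(p_{ij})$ of real numbers with $p_{ij}>0$ and $\sum_{i,j=1}^{I}p_{ij}=1$ (probability tables). For a table $\mathbf{R}=(r_{ij})$ with positive entries, the closure is $\mathcal{C}\mathbf{R}=\big(r_{ij}/\sum_{k,l}r_{kl}\big)_{ij}$. Perturbation: $\mathbf{P}\oplus\mathbf{Q}=\mathcal{C}(p_{ij}q_{ij})$; powering by $\alpha\in\mathbb{R}$: $\alpha\odot\mathbf{P}=\mathcal{C}(p_{ij}^{\alpha})$; $\mathbf{P}\ominus\mathbf{Q}=\mathbf{P}\oplus((-1)\odot\mathbf{Q})$. With $\oplus$ as addition and $\odot$ as scalar multiplication $\mathcal{S}^{I^2}$ is a real vector space of dimension $I^2-1$. $T(\mathbf{P})$ denotes the transposed table, with $(i,j)$ entry $p_{ji}$. The centered log-ratio transform of $\mathbf{P}$ is the table $\mathrm{clr}(\mathbf{P})$ with entries $\mathrm{clr}_{ij}(\mathbf{P})=\log\big(p_{ij}/g(\mathbf{P})\big)$,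 $g(\mathbf{P})=\big(\prod_{i,j}p_{ij}\big)^{1/I^2}$. The Aitchison inner product and norm are $\langle\mathbf{P},\mathbf{Q}\rangle_A=\sum_{i,j}\mathrm{clr}_{ij}(\mathbf{P})\,\mathrm{clr}_{ij}(\mathbf{Q})$ and $\|\mathbf{P}\|_A=\langle\mathbf{P},\mathbf{P}\rangle_A^{1/2}$. Let $g(row_i[\mathbf{P}])=\big(\prod_{j=1}^{I}p_{ij}\big)^{1/I}$ and $g(col_j[\mathbf{P}])=\big(\prod_{i=1}^{I}p_{ij}\big)^{1/I}$. Let $row(\mathbf{P})$ be the closure of the table whose $(i,j)$ entry is $g(row_i[\mathbf{P}])$, and $col(\mathbf{P})$ the closure of the table whose $(i,j)$ entry is $g(col_j[\mathbf{P}])$. Put $\mathbf{P}_{\mathrm{ind}}=row(\mathbf{P})\oplus col(\mathbf{P})$ and $\mathbf{P}_{\mathrm{int}}=\mathbf{P}\ominus\mathbf{P}_{\mathrm{ind}}$. The symmetric component is $\mathbf{P}_{\mathrm{sym}}=0.5\odot(\mathbf{P}\oplus T(\mathbf{P}))$ and the skew-symmetric component is $\mathbf{P}_{\mathrm{skew}}=\mathbf{P}\ominus\mathbf{P}_{\mathrm{sym}}$. The quasi-symmetric component is $\mathbf{P}_{\mathrm{QS}}=\mathbf{P}_{\mathrm{ind}}\oplus\big(0.5\odot(\mathbf{P}_{\mathrm{int}}\oplus T(\mathbf{P}_{\mathrm{int}}))\big)$, and $\mathbf{P}_{\mathrm{skint}}=\mathbf{P}\ominus\mathbf{P}_{\mathrm{QS}}$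 is the skew-symmetric interaction component. The geometric marginal homogeneous component is $\mathbf{P}_{\mathrm{GMH}}=\big(0.5\odot(\mathbf{P}_{\mathrm{ind}}\oplus T(\mathbf{P}_{\mathrm{ind}}))\big)\oplus\mathbf{P}_{\mathrm{int}}$, and $\mathbf{P}_{\mathrm{skind}}=\mathbf{P}\ominus\mathbf{P}_{\mathrm{GMH}}$ is the skew-symmetric independent component. *)

theory Defs
  imports "HOL-Analysis.Analysis"
begin

text \<open>An \<open>I \<times> I\<close> table is a matrix over a finite index type \<open>'n\<close>, with \<open>I = CARD('n)\<close>;
  the row index comes first, so \<open>p\<^sub>i\<^sub>j\<close> is \<open>P $ i $ j\<close>.\<close>

type_synonym 'n table = "real ^ 'n ^ 'n"

definition prob_tables :: "('n::finite) table set" where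
  "prob_tables = {P. (\<forall>i j. P $ i $ j > 0) \<and> (\<Sum>i\<in>UNIV. \<Sum>j\<in>UNIV. P $ i $ j) = 1}"

text \<open>The compositional closure (normalisation), unrelated to the topological \<^const>\<open>closure\<close>.
  This and all operations below are meant for tables with positive entries.\<close>

definition table_closure :: "('n::finite) table \<Rightarrow> 'n table" where
  "table_closure R = (\<chi> i j. R $ i $ j / (\<Sum>k\<in>UNIV. \<Sum>l\<in>UNIV. R $ k $ l))"

definition perturb :: "('n::finite) table \<Rightarrow> 'n table \<Rightarrow> 'n table"  (infixl "\<oplus>\<^sub>A" 65) where
  "P \<oplus>\<^sub>A Q = table_closure (\<chi> i j. P $ i $ j * Q $ i $ j)"

definition powering :: "real \<Rightarrow> ('n::finite) table \<Rightarrow> 'n table"  (infixr "\<odot>\<^sub>A" 75) where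
  "\<alpha> \<odot>\<^sub>A P = table_closure (\<chi> i j. P $ i $ j powr \<alpha>)"

definition perturb_diff :: "('n::finite) table \<Rightarrow> 'n table \<Rightarrow> 'n table"  (infixl "\<ominus>\<^sub>A" 65) where
  "P \<ominus>\<^sub>A Q = P \<oplus>\<^sub>A ((-1) \<odot>\<^sub>A Q)"

definition geo_mean :: "('n::finite) table \<Rightarrow> real" where
  "geo_mean P = (\<Prod>i\<in>UNIV. \<Prod>j\<in>UNIV. P $ i $ j) powr (1 / real (CARD('n) ^ 2))"

definition clr :: "('n::finite) table \<Rightarrow> 'n table" where
  "clr P = (\<chi> i j. ln (P $ i $ j / geo_mean P))"

definition aitchison_inner :: "('n::finite) table \<Rightarrow> 'n table \<Rightarrow> real" where
  "aitchison_inner P Q = (\<Sum>i\<in>UNIV. \<Sum>j\<in>UNIV. clr P $ i $ j * clr Q $ i $ j)"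

definition aitchison_norm :: "('n::finite) table \<Rightarrow> real" where
  "aitchison_norm P = sqrt (aitchison_inner P P)"

definition row_geo_mean :: "('n::finite) table \<Rightarrow> 'n \<Rightarrow> real" where
  "row_geo_mean P i = (\<Prod>j\<in>UNIV. P $ i $ j) powr (1 / real CARD('n))"

definition col_geo_mean :: "('n::finite) table \<Rightarrow> 'n \<Rightarrow> real" where
  "col_geo_mean P j = (\<Prod>i\<in>UNIV. P $ i $ j) powr (1 / real CARD('n))"

definition row_table :: "('n::finite) table \<Rightarrow> 'n table" where
  "row_table P = table_closure (\<chi> i j. row_geo_mean P i)"

definition col_table :: "('n::finite) table \<Rightarrow> 'n table" where
  "col_table P = table_closure (\<chi> i j. col_geo_mean P j)"

definition ind_part :: "('n::finite) table \<Rightarrow> 'n table" where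
  "ind_part P = row_table P \<oplus>\<^sub>A col_table P"

definition int_part :: "('n::finite) table \<Rightarrow> 'n table" where
  "int_part P = P \<ominus>\<^sub>A ind_part P"

definition sym_part :: "('n::finite) table \<Rightarrow> 'n table" where
  "sym_part P = 0.5 \<odot>\<^sub>A (P \<oplus>\<^sub>A transpose P)"

definition skew_part :: "('n::finite) table \<Rightarrow> 'n table" where
  "skew_part P = P \<ominus>\<^sub>A sym_part P"

text \<open>QS: quasi-symmetric; skint: skew-symmetric interaction;
  GMH: geometric marginal homogeneous; skind: skew-symmetric independent.\<close>

definition QS_part :: "('n::finite) table \<Rightarrow> 'n table" where
  "QS_part P = ind_part P \<oplus>\<^sub>A (0.5 \<odot>\<^sub>A (int_part P \<oplus>\<^sub>A transpose (int_part P)))"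

definition skint_part :: "('n::finite) table \<Rightarrow> 'n table" where
  "skint_part P = P \<ominus>\<^sub>A QS_part P"

definition GMH_part :: "('n::finite) table \<Rightarrow> 'n table" where
  "GMH_part P = (0.5 \<odot>\<^sub>A (ind_part P \<oplus>\<^sub>A transpose (ind_part P))) \<oplus>\<^sub>A int_part P"

definition skind_part :: "('n::finite) table \<Rightarrow> 'n table" where
  "skind_part P = P \<ominus>\<^sub>A GMH_part P"

definition simplicial_skewness :: "('n::finite) table \<Rightarrow> real" where
  "simplicial_skewness P = (aitchison_norm (skew_part P))\<^sup>2"

definition simplicial_quasi_skewness :: "('n::finite) table \<Rightarrow> real" where
  "simplicial_quasi_skewness P = (aitchison_norm (skint_part P))\<^sup>2"

definition simplicial_geo_marginal_heterogeneity :: "('n::finite) table \<Rightarrow> real" where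
  "simplicial_geo_marginal_heterogeneity P = (aitchison_norm (skind_part P))\<^sup>2"

end

theory Submission
  imports Defs
begin

text \<open>The map \<^const>\<open>clr\<close> turns perturbation and powering into addition and scaling of matrices,
  and commutes with transposition. It sends the independent component to a matrix of the form
  \<open>a\<^sub>i + b\<^sub>j\<close> and the interaction component to one whose rows and columns all sum to zero; both
  shapes survive skew-symmetrisation. Hence the skewness is the sum of a skew-symmetric
  interaction term and a skew-symmetric independent term that are orthogonal, and the
  claim is Pythagoras' theorem.\<close>

text \<open>Weaker than membership in \<open>prob_tables\<close>: the entrywise products, powers and
  geometric means that get normalised are positive but need not sum to 1, and the \<open>clr\<close>
  calculus needs only positivity.\<close>

definition pos_table :: "('n::finite) table \<Rightarrow> bool" where
  "pos_table P \<longleftrightarrow> (\<forall>i j. P $ i $ j > 0)"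

lemma pos_table_nonzero:
  assumes "pos_table P"
  shows "P $ i $ j \<noteq> 0"
  using assms unfolding pos_table_def by (metis less_irrefl)

section \<open>Positivity under closure and the simplicial operations\<close>

lemma sum_pos_table:
  fixes R :: "('n::finite) table"
  assumes "pos_table R"
  shows "(\<Sum>k\<in>UNIV. \<Sum>l\<in>UNIV. R $ k $ l) > 0"
  using assms unfolding pos_table_def by (intro sum_pos) auto

lemma pos_table_closure:
  assumes "pos_table R"
  shows "pos_table (table_closure R)"
  using assms sum_pos_table[OF assms] by (simp add: pos_table_def table_closure_def)

lemma pos_perturb:
  assumes "pos_table P" "pos_table Q"
  shows "pos_table (P \<oplus>\<^sub>A Q)"
  unfolding perturb_def using assms by (intro pos_table_closure) (simp add: pos_table_def)

lemma pos_powering: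
  assumes "pos_table P"
  shows "pos_table (\<alpha> \<odot>\<^sub>A P)"
  unfolding powering_def using pos_table_nonzero[OF assms]
  by (intro pos_table_closure) (simp add: pos_table_def)

lemma pos_perturb_diff:
  assumes "pos_table P" "pos_table Q"
  shows "pos_table (P \<ominus>\<^sub>A Q)"
  unfolding perturb_diff_def using assms by (intro pos_perturb pos_powering)

lemma pos_transpose:
  assumes "pos_table P"
  shows "pos_table (transpose P)"
  using assms by (simp add: pos_table_def transpose_def)

lemma row_geo_mean_pos:
  assumes "pos_table P"
  shows "row_geo_mean P i > 0"
  by (simp add: row_geo_mean_def pos_table_nonzero assms)

lemma col_geo_mean_pos:
  assumes "pos_table P"
  shows "col_geo_mean P j > 0"
  by (simp add: col_geo_mean_def pos_table_nonzero assms)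

lemma pos_row_table:
  assumes "pos_table P"
  shows "pos_table (row_table P)"
  unfolding row_table_def using row_geo_mean_pos[OF assms]
  by (intro pos_table_closure) (simp add: pos_table_def)

lemma pos_col_table:
  assumes "pos_table P"
  shows "pos_table (col_table P)"
  unfolding col_table_def using col_geo_mean_pos[OF assms]
  by (intro pos_table_closure) (simp add: pos_table_def)

lemma pos_ind_part:
  assumes "pos_table P"
  shows "pos_table (ind_part P)"
  unfolding ind_part_def using assms by (intro pos_perturb pos_row_table pos_col_table)

lemma pos_int_part:
  assumes "pos_table P"
  shows "pos_table (int_part P)"
  unfolding int_part_def using assms by (intro pos_perturb_diff pos_ind_part)

section \<open>Centred log-ratio coordinates\<close>

lemma ln_row_geo_mean:
  fixes P :: "('n::finite) table"
  assumes "pos_table P"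
  shows "ln (row_geo_mean P i) = (\<Sum>j\<in>UNIV. ln (P $ i $ j)) / real CARD('n)"
proof -
  have "ln (\<Prod>j\<in>UNIV. P $ i $ j) = (\<Sum>j\<in>UNIV. ln (P $ i $ j))"
    by (intro ln_prod) (simp_all add: pos_table_nonzero assms)
  then show ?thesis
    by (simp add: row_geo_mean_def ln_powr pos_table_nonzero assms)
qed

lemma ln_col_geo_mean:
  fixes P :: "('n::finite) table"
  assumes "pos_table P"
  shows "ln (col_geo_mean P j) = (\<Sum>i\<in>UNIV. ln (P $ i $ j)) / real CARD('n)"
proof -
  have "col_geo_mean P j = row_geo_mean (transpose P) j"
    by (simp add: col_geo_mean_def row_geo_mean_def transpose_def)
  then show ?thesis
    using ln_row_geo_mean[OF pos_transpose[OF assms]] by (simp add: transpose_def)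
qed

text \<open>The log of a geometric mean is the arithmetic mean of the logs, so \<open>clr\<close>
  centres the entrywise logarithm. In this form everything below is linear in the logs.\<close>

lemma clr_eq:
  fixes P :: "('n::finite) table"
  assumes "pos_table P"
  shows "clr P $ i $ j
    = ln (P $ i $ j) - (\<Sum>k\<in>UNIV. \<Sum>l\<in>UNIV. ln (P $ k $ l)) / (real CARD('n))\<^sup>2"
proof -
  have "ln (\<Prod>k\<in>UNIV. \<Prod>l\<in>UNIV. P $ k $ l) = (\<Sum>k\<in>UNIV. ln (\<Prod>l\<in>UNIV. P $ k $ l))"
    by (intro ln_prod) (simp_all add: pos_table_nonzero assms)
  moreover have "ln (\<Prod>l\<in>UNIV. P $ k $ l) = (\<Sum>l\<in>UNIV. ln (P $ k $ l))" for k
    by (intro ln_prod) (simp_all add: pos_table_nonzero assms)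
  ultimately show ?thesis
    by (simp add: clr_def geo_mean_def ln_div ln_powr pos_table_nonzero assms)
qed

lemma sum_clr:
  fixes P :: "('n::finite) table"
  assumes "pos_table P"
  shows "(\<Sum>i\<in>UNIV. \<Sum>j\<in>UNIV. clr P $ i $ j) = 0"
  by (simp add: clr_eq[OF assms] sum_subtractf power2_eq_square)

text \<open>Dividing by the total shifts all logs by one constant, which centring removes. Hence the
  normalisations inside all operations can be ignored.\<close>

lemma clr_table_closure:
  fixes R :: "('n::finite) table"
  assumes "pos_table R"
  shows "clr (table_closure R) = clr R"
proof -
  define s where "s = (\<Sum>k\<in>UNIV. \<Sum>l\<in>UNIV. R $ k $ l)"
  have "s \<noteq> 0"
    using sum_pos_table[OF assms] by (simp add: s_def)
  then have "ln (table_closure R $ i $ j) = ln (R $ i $ j) - ln s" for i j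
    by (simp add: table_closure_def ln_div pos_table_nonzero assms flip: s_def)
  then show ?thesis
    by (simp add: vec_eq_iff clr_eq pos_table_closure assms sum_subtractf diff_divide_distrib
        power2_eq_square)
qed

lemma clr_perturb:
  fixes P Q :: "('n::finite) table"
  assumes "pos_table P" "pos_table Q"
  shows "clr (P \<oplus>\<^sub>A Q) = clr P + clr Q"
proof -
  let ?R = "\<chi> i j. P $ i $ j * Q $ i $ j"
  have pos: "pos_table ?R"
    using assms by (simp add: pos_table_def)
  have "ln (P $ i $ j * Q $ i $ j) = ln (P $ i $ j) + ln (Q $ i $ j)" for i j
    by (simp add: ln_mult pos_table_nonzero assms)
  then show ?thesis
    by (simp add: perturb_def clr_table_closure pos vec_eq_iff clr_eq assms sum.distrib
        add_divide_distrib)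
qed

lemma clr_powering:
  fixes P :: "('n::finite) table"
  assumes "pos_table P"
  shows "clr (\<alpha> \<odot>\<^sub>A P) = \<alpha> *\<^sub>R clr P"
proof -
  let ?R = "\<chi> i j. P $ i $ j powr \<alpha>"
  have pos: "pos_table ?R"
    using pos_table_nonzero[OF assms] by (simp add: pos_table_def)
  have "ln (P $ i $ j powr \<alpha>) = \<alpha> * ln (P $ i $ j)" for i j
    by (simp add: ln_powr pos_table_nonzero assms)
  then show ?thesis
    by (simp add: powering_def clr_table_closure pos vec_eq_iff clr_eq assms right_diff_distrib
        flip: sum_distrib_left)
qed

lemma clr_perturb_diff:
  assumes "pos_table P" "pos_table Q"
  shows "clr (P \<ominus>\<^sub>A Q) = clr P - clr Q"
  using assms by (simp add: perturb_diff_def clr_perturb clr_powering pos_powering)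

lemma clr_transpose:
  fixes P :: "('n::finite) table"
  assumes "pos_table P"
  shows "clr (transpose P) = transpose (clr P)"
proof -
  have "(\<Sum>k\<in>UNIV. \<Sum>l\<in>UNIV. ln (P $ l $ k)) = (\<Sum>k\<in>UNIV. \<Sum>l\<in>UNIV. ln (P $ k $ l))"
    by (rule sum.swap)
  then show ?thesis
    \<comment> \<open>\<open>transpose\<close> is unfolded only in the second pass; unfolded
      earlier, it would keep \<open>pos_transpose\<close> from matching.\<close>
    by (simp add: vec_eq_iff clr_eq pos_transpose assms) (simp add: transpose_def clr_eq assms)
qed

section \<open>Coordinates of the independent and interaction components\<close>

lemma clr_row_table:
  fixes P :: "('n::finite) table"
  assumes "pos_table P"
  shows "clr (row_table P) $ i $ j = (\<Sum>l\<in>UNIV. clr P $ i $ l) / real CARD('n)"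
proof -
  have pos: "pos_table (\<chi> i j. row_geo_mean P i :: 'n table)"
    using row_geo_mean_pos[OF assms] by (simp add: pos_table_def)
  \<comment> \<open>The logs of the row geometric means average to the grand mean of the logs of
    \<open>P\<close>. Centring thus leaves row mean minus grand mean, which is the row mean of
    \<open>clr P\<close>.\<close>
  show ?thesis
    by (simp add: row_table_def clr_table_closure pos clr_eq assms ln_row_geo_mean sum_subtractf
        diff_divide_distrib power2_eq_square flip: sum_divide_distrib)
qed

lemma clr_col_table:
  fixes P :: "('n::finite) table"
  assumes "pos_table P"
  shows "clr (col_table P) $ i $ j = (\<Sum>k\<in>UNIV. clr P $ k $ j) / real CARD('n)"
proof -
  have "col_table P = transpose (row_table (transpose P))"
    by (simp add: vec_eq_iff col_table_def row_table_def table_closure_def transpose_def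
        col_geo_mean_def row_geo_mean_def sum_distrib_left)
  then show ?thesis
    using clr_row_table[OF pos_transpose[OF assms], of j i]
    by (simp add: clr_transpose pos_row_table pos_transpose assms)
      (simp add: transpose_def)
qed

lemma clr_ind_part:
  fixes P :: "('n::finite) table"
  assumes "pos_table P"
  shows "clr (ind_part P) $ i $ j
    = (\<Sum>l\<in>UNIV. clr P $ i $ l) / real CARD('n) + (\<Sum>k\<in>UNIV. clr P $ k $ j) / real CARD('n)"
  by (simp add: ind_part_def clr_perturb pos_row_table pos_col_table clr_row_table clr_col_table
      assms)

lemma clr_int_part:
  assumes "pos_table P"
  shows "clr (int_part P) = clr P - clr (ind_part P)"
  by (simp add: int_part_def clr_perturb_diff pos_ind_part assms)

text \<open>Subtracting the row mean from each entry cancels the row sum; the column means add up to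
  a multiple of the total of \<open>clr P\<close>, which is 0 by \<open>sum_clr\<close>.\<close>

lemma sum_row_clr_int_part:
  fixes P :: "('n::finite) table"
  assumes "pos_table P"
  shows "(\<Sum>j\<in>UNIV. clr (int_part P) $ i $ j) = 0"
proof -
  have "(\<Sum>j\<in>UNIV. \<Sum>k\<in>UNIV. clr P $ k $ j) = 0"
    using sum_clr[OF assms] by (subst sum.swap)
  then show ?thesis
    by (simp add: clr_int_part clr_ind_part assms sum_subtractf sum.distrib
        flip: sum_divide_distrib)
qed

lemma sum_col_clr_int_part:
  fixes P :: "('n::finite) table"
  assumes "pos_table P"
  shows "(\<Sum>i\<in>UNIV. clr (int_part P) $ i $ j) = 0"
  using sum_clr[OF assms]
  by (simp add: clr_int_part clr_ind_part assms sum_subtractf sum.distrib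
      flip: sum_divide_distrib)

section \<open>Coordinates of the skew-symmetric components\<close>

lemma clr_skew_part:
  assumes "pos_table P"
  shows "clr (skew_part P) = (1/2) *\<^sub>R (clr P - transpose (clr P))"
  by (simp add: skew_part_def sym_part_def clr_perturb_diff clr_powering clr_perturb clr_transpose
      pos_powering pos_perturb pos_transpose assms vec_eq_iff field_simps)

text \<open>\<open>QS_part\<close> symmetrises only the interaction component, so the independent
  component cancels in the difference from \<open>P\<close>. In \<open>clr_skind_part\<close> the
  two roles are exchanged.\<close>

lemma clr_skint_part:
  assumes "pos_table P"
  shows "clr (skint_part P) = (1/2) *\<^sub>R (clr (int_part P) - transpose (clr (int_part P)))"
proof -
  have "clr P = clr (ind_part P) + clr (int_part P)"
    by (simp add: clr_int_part assms)
  then show ?thesis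
    by (simp add: skint_part_def QS_part_def clr_perturb_diff clr_powering clr_perturb
        clr_transpose pos_powering pos_perturb pos_transpose pos_ind_part pos_int_part assms
        vec_eq_iff field_simps)
qed

lemma clr_skind_part:
  assumes "pos_table P"
  shows "clr (skind_part P) = (1/2) *\<^sub>R (clr (ind_part P) - transpose (clr (ind_part P)))"
proof -
  have "clr P = clr (ind_part P) + clr (int_part P)"
    by (simp add: clr_int_part assms)
  then show ?thesis
    by (simp add: skind_part_def GMH_part_def clr_perturb_diff clr_powering clr_perturb
        clr_transpose pos_powering pos_perturb pos_transpose pos_ind_part pos_int_part assms
        vec_eq_iff field_simps)
qed

section \<open>Orthogonality and Pythagoras\<close>

lemma aitchison_inner_eq: "aitchison_inner P Q = clr P \<bullet> clr Q"
  by (simp add: aitchison_inner_def inner_vec_def)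

lemma aitchison_norm_eq: "aitchison_norm P = norm (clr P)"
  by (simp add: aitchison_norm_def aitchison_inner_eq norm_eq_sqrt_inner)

text \<open>The terms with \<open>a i\<close> vanish by summing along rows first, those with
  \<open>b j\<close> by summing along columns first.\<close>

lemma inner_additive_zero_margins:
  fixes y u :: "real ^ 'n ^ 'm"
  assumes "\<And>i. (\<Sum>j\<in>UNIV. y $ i $ j) = 0" "\<And>j. (\<Sum>i\<in>UNIV. y $ i $ j) = 0"
    and "\<And>i j. u $ i $ j = a i + b j"
  shows "y \<bullet> u = 0"
proof -
  have "y \<bullet> u = (\<Sum>i\<in>UNIV. \<Sum>j\<in>UNIV. y $ i $ j * a i) + (\<Sum>i\<in>UNIV. \<Sum>j\<in>UNIV. y $ i $ j * b j)"
    by (simp add: inner_vec_def assms(3) distrib_left sum.distrib)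
  also have "(\<Sum>i\<in>UNIV. \<Sum>j\<in>UNIV. y $ i $ j * b j) = (\<Sum>j\<in>UNIV. \<Sum>i\<in>UNIV. y $ i $ j * b j)"
    by (rule sum.swap)
  finally show ?thesis
    by (simp add: assms(1,2) flip: sum_distrib_right)
qed

lemma orthogonal_skint_skind:
  fixes P :: "('n::finite) table"
  assumes "pos_table P"
  shows "orthogonal (clr (skint_part P)) (clr (skind_part P))"
  unfolding orthogonal_def
proof (rule inner_additive_zero_margins)
  \<comment> \<open>Half the gap between the row mean and the column mean of \<open>clr P\<close> at
    one index. Skew-symmetrising row mean plus column mean leaves this gap at \<open>i\<close> minus
    the gap at \<open>j\<close>.\<close>
  let ?d = "\<lambda>i. ((\<Sum>l\<in>UNIV. clr P $ i $ l) - (\<Sum>k\<in>UNIV. clr P $ k $ i)) / (2 * real CARD('n))"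
  show "(\<Sum>j\<in>UNIV. clr (skint_part P) $ i $ j) = 0" for i
    by (simp add: clr_skint_part assms transpose_def sum_subtractf sum_row_clr_int_part
        sum_col_clr_int_part flip: sum_divide_distrib)
  show "(\<Sum>i\<in>UNIV. clr (skint_part P) $ i $ j) = 0" for j
    by (simp add: clr_skint_part assms transpose_def sum_subtractf sum_row_clr_int_part
        sum_col_clr_int_part flip: sum_divide_distrib)
  show "clr (skind_part P) $ i $ j = ?d i + - ?d j" for i j
    by (simp add: clr_skind_part clr_ind_part assms transpose_def field_simps)
qed

theorem theorem7:
  fixes P :: "('n::finite) table"
  assumes "P \<in> prob_tables"
  shows "simplicial_skewness P
       = simplicial_quasi_skewness P + simplicial_geo_marginal_heterogeneity P"
proof -
  have pos: "pos_table P"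
    using assms by (simp add: prob_tables_def pos_table_def)
  \<comment> \<open>Skew-symmetrisation is linear, so it splits along
    \<open>clr P = clr (ind_part P) + clr (int_part P)\<close>.\<close>
  have "clr (skew_part P) = clr (skint_part P) + clr (skind_part P)"
    by (simp add: clr_skew_part clr_skint_part clr_skind_part clr_int_part pos vec_eq_iff
        transpose_def field_simps)
  then show ?thesis
    using norm_add_Pythagorean[OF orthogonal_skint_skind[OF pos]]
    by (simp add: simplicial_skewness_def simplicial_quasi_skewness_def
        simplicial_geo_marginal_heterogeneity_def aitchison_norm_eq)
qed

end
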